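(* Let $T$ be a tree and let $P_n=v_1v_2\cdots v_n$ be a diametrical path of $T$ (on $n$ vertices, labelled in order along the path). If $n$ is odd, then $\operatorname{mr}^-(T)=\operatorname{mr}^-(P_n)$ if and only if $T$ is a regular centipede (with respect to the path $P_n$) all of whose joints are even-indexed vertices of $P_n$. If $n$ is even, then $\operatorname{mr}^-(T)=\operatorname{mr}^-(P_n)$ if and only if $T$ is a centipede (with respect to the path $P_n$) with the property that no pair of joints $v_r$ and $v_s$ of $P_n$ satisfies $r$ odd, $s$ even, and $3\le r<s\le n-2$.
   Context: All graphs are finite, simple and undirected. For a graph $G$ with vertices $v_1,\dots,v_m$, let $\mathcal{S}^-(G)$ be the set of real skew-symmetric $m\times m$ matrices $A$ such that for $i\neq j$, $a_{ij}\neq 0$ if and only if $\{v_i,v_j\}$ is an edge of $G$. The minimum skew rank is $\operatorname{mr}^-(G)=\min\{\operatorname{rank}A : A\in\mathcal{S}^-(G)\}$. A diametrical path of a connected graph $G$ is an induced path in $G$ whose length (number of edges) equals the diameter of $G$ (the maximum over pairs of vertices of the length of a shortest path between them). A centipede is a tree consisting of a path $P$ together with additional edges (legs) each joining a nonpendant vertex of $P$ to a new pendant vertex; the vertices of $P$ that have legs are called joints. A centipede is regular if no two consecutive vertices of $P$ are joints. *)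

theory Defs
  imports "Graph_Theory.Graph_Theory" "Jordan_Normal_Form.DL_Rank"
begin

text \<open>
  A finite simple undirected graph is a \<open>pair_graph\<close>: a finite, loopfree, symmetric relation
  \<open>parcs\<close> on the vertex set \<open>pverts\<close>, each edge being represented by both of its
  orientations.
\<close>

definition skew_mats :: "'a list \<Rightarrow> 'a pair_pre_digraph \<Rightarrow> real mat set" where
  "skew_mats vs G = {A \<in> carrier_mat (length vs) (length vs).
     transpose_mat A = - A \<and>
     (\<forall>i < length vs. \<forall>j < length vs.
        i \<noteq> j \<longrightarrow> (A $$ (i, j) \<noteq> 0 \<longleftrightarrow> (vs ! i, vs ! j) \<in> parcs G))}"

text \<open>
  The minimum is taken over all labellings \<open>vs\<close> of the vertices as well; relabelling conjugates
  a matrix by a permutation matrix, so each labelling gives the same set of ranks.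
\<close>

definition min_skew_rank :: "'a pair_pre_digraph \<Rightarrow> nat" where
  "min_skew_rank G = (LEAST r. \<exists>vs A. distinct vs \<and> set vs = pverts G \<and>
     A \<in> skew_mats vs G \<and> r = vec_space.rank (length vs) A)"

text \<open>
  The constant \<open>tree\<close> of the graph library is meant for directed graphs: there the two
  orientations of an edge form a cycle of length 2, so only closed walks of length at least 3
  count as cycles here.
\<close>

definition undirected_tree :: "'a pair_pre_digraph \<Rightarrow> bool" where
  "undirected_tree G \<longleftrightarrow> pair_graph G \<and> Digraph_Component.connected (with_proj G) \<and>
     \<not> (\<exists>c. pre_digraph.cycle (with_proj G) c \<and> 3 \<le> length c)"

definition graph_dist :: "'a pair_pre_digraph \<Rightarrow> 'a \<Rightarrow> 'a \<Rightarrow> nat" where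
  "graph_dist G u v = (LEAST k. \<exists>q. vpath q (with_proj G) \<and> hd q = u \<and> last q = v \<and>
     k = vwalk_length q)"

definition diameter :: "'a pair_pre_digraph \<Rightarrow> nat" where
  "diameter G = Max {graph_dist G u v | u v. u \<in> pverts G \<and> v \<in> pverts G}"

definition path_graph :: "'a list \<Rightarrow> 'a pair_pre_digraph" where
  "path_graph p = \<lparr> pverts = set p, parcs = set (vwalk_arcs p) \<union> (set (vwalk_arcs p))\<inverse> \<rparr>"

definition diametrical_path :: "'a pair_pre_digraph \<Rightarrow> 'a list \<Rightarrow> bool" where
  "diametrical_path G p \<longleftrightarrow> vpath p (with_proj G) \<and>
     induced_subgraph (with_proj (path_graph p)) (with_proj G) \<and>
     vwalk_length p = diameter G"

text \<open>
  A leg is oriented from the vertex of the path to the vertex outside of it. Several legs may share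
  their vertex on the path; injectivity of \<open>snd\<close> in \<open>centipede\<close> says that distinct legs have
  distinct outer ends, which together with the description of all edges makes these ends pendant.
\<close>

definition legs :: "'a pair_pre_digraph \<Rightarrow> 'a list \<Rightarrow> ('a \<times> 'a) set" where
  "legs G p = {(u, w) \<in> parcs G. u \<in> set p \<and> w \<notin> set p}"

definition centipede :: "'a pair_pre_digraph \<Rightarrow> 'a list \<Rightarrow> bool" where
  "centipede G p \<longleftrightarrow> undirected_tree G \<and> vpath p (with_proj G) \<and>
     pverts G = set p \<union> snd ` legs G p \<and>
     parcs G = parcs (path_graph p) \<union> legs G p \<union> (legs G p)\<inverse> \<and>
     inj_on snd (legs G p) \<and>
     (\<forall>(u, w) \<in> legs G p. out_degree (with_proj (path_graph p)) u \<noteq> 1)"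

text \<open>Indices along the path are 1-based, whereas lists are 0-based.\<close>

definition joint_indices :: "'a pair_pre_digraph \<Rightarrow> 'a list \<Rightarrow> nat set" where
  "joint_indices G p = {i. 1 \<le> i \<and> i \<le> length p \<and> p ! (i - 1) \<in> fst ` legs G p}"

definition regular_centipede :: "'a pair_pre_digraph \<Rightarrow> 'a list \<Rightarrow> bool" where
  "regular_centipede G p \<longleftrightarrow> centipede G p \<and>
     \<not> (\<exists>i. i \<in> joint_indices G p \<and> i + 1 \<in> joint_indices G p)"

end

theory Submission
  imports Defs
begin

text \<open>
  Vertex covers bound the rank from above: if \<open>C\<close> covers all edges, the column space of a
  matrix in \<open>\<S>\<^sup>-(G)\<close> is spanned by the columns in \<open>C\<close> and the unit vectors of \<open>C\<close>, so
  the rank is at most \<open>2 |C|\<close>. Skew zero forcing bounds it from below: if every kernel vector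
  supported on \<open>S\<close> can be seen to vanish row by row, the columns in \<open>S\<close> are independent. For the
  path both bounds are \<open>2 \<lfloor>n/2\<rfloor>\<close>, and the lower bound is inherited by \<open>T\<close>. Each violation of
  the stated conditions (a vertex at distance 2 from the path; for odd \<open>n\<close>, a joint of odd index; for
  even \<open>n\<close>, an odd joint before an even one) amounts to a matching with more than \<open>\<lfloor>n/2\<rfloor>\<close> edges
  whose vertex set can be forced, which raises the rank by 2. Conversely, the conditions provide a
  vertex cover consisting of even path vertices up to some index and odd ones after it.
\<close>

section \<open>Bounds for the minimum skew rank\<close>

text \<open>The rank is the size of a maximal independent set \<open>U\<close> of columns. In the
  subspace spanned by \<open>Y\<close>, regarded as a vector space of its own, an independent set is
  at most as large as a generating one.\<close>

lemma (in vec_space) rank_le_card_spanning: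
  assumes A: "A \<in> carrier_mat n nc" and Y: "finite Y" "Y \<subseteq> carrier_vec n"
    and cols: "set (cols A) \<subseteq> span Y"
  shows "rank A \<le> card Y"
proof -
  obtain U where U: "maximal U (\<lambda>T. T \<subseteq> set (cols A) \<and> lin_indpt T)" "finite U"
    using maximal_exists_superset[of "set (cols A)" "\<lambda>T. T \<subseteq> set (cols A) \<and> lin_indpt T" "{}"]
      finite_lin_indpt2 by auto
  then have UA: "U \<subseteq> set (cols A)" and li: "lin_indpt U"
    by (auto simp: maximal_def)
  have sub: "submodule class_ring (span Y) V"
    using Y by (simp add: span_is_submodule)
  have vs: "vectorspace class_ring (span_vs Y)"
    using Y span_is_subspace subspace_def subspace_is_vs by simp
  have Y_in: "Y \<subseteq> span Y"
    using Y in_own_span by simp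
  have gen: "LinearCombinations.module.span class_ring (span_vs Y) Y = carrier (span_vs Y)"
    using span_li_not_depend(1)[OF Y_in sub] by simp
  have li': "LinearCombinations.module.lin_indpt class_ring (span_vs Y) U"
    using span_li_not_depend(2)[OF _ sub] li UA cols by blast
  have "card U \<le> card Y"
    using vectorspace.li_smaller_than_gen[OF vs U(2) Y(1) _ _ li' gen] UA cols Y_in by auto
  then show ?thesis
    using rank_card_indpt[OF A U(1)] by simp
qed

text \<open>The hypothesis \<open>ker\<close> excludes nontrivial relations whose coefficients are
  indexed by positions, not by vectors. Equal columns have to be ruled out first, so that
  independence of the set of columns bounds \<open>card S\<close>.\<close>

lemma (in vec_space) card_le_rank:
  assumes A: "A \<in> carrier_mat n nc" and S: "S \<subseteq> {..<nc}"
    and ker: "\<And>x. (\<And>i. i < n \<Longrightarrow> (\<Sum>j\<in>S. A $$ (i, j) * x j) = 0) \<Longrightarrow> \<forall>j\<in>S. x j = 0"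
  shows "card S \<le> rank A"
proof -
  have fin: "finite S"
    using S finite_subset by blast
  have col: "col A j $ i = A $$ (i, j)" if "i < n" "j \<in> S" for i j
    using that A S by auto
  have inj: "inj_on (col A) S"
  proof (rule inj_onI, rule ccontr)
    fix k l
    assume kl: "k \<in> S" "l \<in> S" "col A k = col A l" "k \<noteq> l"
    \<comment> \<open>If columns \<open>k\<close> and \<open>l\<close> coincide, the difference of
      the two unit coefficient families is a nontrivial relation.\<close>
    let ?x = "\<lambda>j. (if j = k then 1 else 0) - (if j = l then 1 else 0)"
    have "(\<Sum>j\<in>S. A $$ (i, j) * ?x j) = 0" if "i < n" for i
    proof -
      have "(\<Sum>j\<in>S. A $$ (i, j) * ?x j) =
          (\<Sum>j\<in>S. if j = k then A $$ (i, j) else 0) - (\<Sum>j\<in>S. if j = l then A $$ (i, j) else 0)"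
        unfolding sum_subtractf[symmetric] by (rule sum.cong) (auto simp: algebra_simps)
      also have "\<dots> = A $$ (i, k) - A $$ (i, l)"
        using kl fin by (simp add: sum.delta)
      also have "\<dots> = 0"
        using kl(3) col[OF that kl(1)] col[OF that kl(2)] by simp
      finally show ?thesis .
    qed
    from ker[OF this] kl show False
      by fastforce
  qed
  let ?U = "col A ` S"
  have UA: "?U \<subseteq> set (cols A)"
    using A S by (auto simp: cols_def)
  then have carr: "?U \<subseteq> carrier_vec n"
    using A cols_dim by blast
  have "lin_indpt ?U"
  proof
    assume "lin_dep ?U"
    then obtain a w where a: "lincomb a ?U = 0\<^sub>v n" "w \<in> ?U" "a w \<noteq> 0"
      using finite_lin_dep[of ?U] fin carr by auto
    have "(\<Sum>j\<in>S. A $$ (i, j) * a (col A j)) = 0" if i: "i < n" for i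
    proof -
      have "0 = lincomb a ?U $ i"
        using a i by simp
      also have "\<dots> = (\<Sum>j\<in>S. a (col A j) * col A j $ i)"
        unfolding lincomb_index[OF i carr] by (simp add: sum.reindex[OF inj])
      also have "\<dots> = (\<Sum>j\<in>S. A $$ (i, j) * a (col A j))"
        by (rule sum.cong) (simp_all add: col[OF i])
      finally show ?thesis by simp
    qed
    from ker[OF this] a(2,3) show False by auto
  qed
  with rank_ge_card_indpt[OF A UA] show ?thesis
    by (simp add: card_image[OF inj])
qed

text \<open>Membership of \<open>w\<close> in this closure of \<open>B\<close> means that every kernel vector of a matrix in
  \<open>\<S>\<^sup>-(G)\<close> which vanishes on \<open>B\<close> also vanishes at \<open>w\<close>: row \<open>u\<close> of the matrix
  involves, among the coordinates not yet known to be zero, only \<open>w\<close>.\<close>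

inductive_set skew_forced :: "('a \<times> 'a) set \<Rightarrow> 'a set \<Rightarrow> 'a set" for E B where
  base: "w \<in> B \<Longrightarrow> w \<in> skew_forced E B"
| step: "\<lbrakk>(u, w) \<in> E; \<And>w'. \<lbrakk>(u, w') \<in> E; w' \<noteq> w\<rbrakk> \<Longrightarrow> w' \<in> skew_forced E B\<rbrakk>
    \<Longrightarrow> w \<in> skew_forced E B"

text \<open>In the row of \<open>u\<close> all terms except the one at \<open>w\<close> vanish, by
  nonadjacency or by induction, and the entry at \<open>w\<close> is nonzero. Summing over
  \<open>S\<close> only amounts to setting the vector to zero on \<open>B\<close>.\<close>

lemma skew_forced_imp_kernel_zero:
  assumes G: "pair_graph G" and vs: "distinct vs" "set vs = pverts G"
    and A: "A \<in> skew_mats vs G"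
    and S: "S = {j. j < length vs \<and> vs ! j \<notin> B}"
    and ker: "\<And>i. i < length vs \<Longrightarrow> (\<Sum>j\<in>S. A $$ (i, j) * x j) = 0"
    and w: "w \<in> skew_forced (parcs G) B"
  shows "\<forall>j\<in>S. vs ! j = w \<longrightarrow> x j = 0"
  using w
proof induction
  case (base w)
  then show ?case using S by auto
next
  case (step u w)
  interpret pair_graph G by fact
  show ?case
  proof (intro ballI impI)
    fix k
    assume k: "k \<in> S" "vs ! k = w"
    have klen: "k < length vs" and fin: "finite S"
      using k S by auto
    obtain i where i: "i < length vs" "vs ! i = u"
      using in_arcsD1[OF step.hyps(1)] vs by (metis in_set_conv_nth)
    have A': "A \<in> carrier_mat (length vs) (length vs)" "transpose_mat A = - A"
      and pat: "\<And>i j. \<lbrakk>i < length vs; j < length vs; i \<noteq> j\<rbrakk>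
        \<Longrightarrow> A $$ (i, j) \<noteq> 0 \<longleftrightarrow> (vs ! i, vs ! j) \<in> parcs G"
      using A by (auto simp: skew_mats_def)
    \<comment> \<open>Skew symmetry makes a diagonal entry its own negative, so the value at
      \<open>u\<close> itself may be unknown when its row is used.\<close>
    have diag: "A $$ (i, i) = 0"
      using arg_cong[OF A'(2), of "\<lambda>M. M $$ (i, i)"] A'(1) i by simp
    have "i \<noteq> k"
      using no_loops'[OF step.hyps(1)] i k by auto
    then have nz: "A $$ (i, k) \<noteq> 0"
      using pat[OF i(1) klen] i k step.hyps(1) by simp
    have "A $$ (i, j) * x j = 0" if j: "j \<in> S - {k}" for j
    proof (cases "A $$ (i, j) = 0")
      case False
      have jlen: "j < length vs"
        using j S by auto
      have "i \<noteq> j"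
        using False diag by auto
      then have "(u, vs ! j) \<in> parcs G"
        using pat[OF i(1) jlen] False i by simp
      moreover have "vs ! j \<noteq> w"
        using vs(1) j k jlen klen nth_eq_iff_index_eq by fastforce
      ultimately show ?thesis
        using step.IH j by auto
    qed simp
    then have "(\<Sum>j\<in>S. A $$ (i, j) * x j) = A $$ (i, k) * x k"
      using sum.remove[OF fin k(1), of "\<lambda>j. A $$ (i, j) * x j"] by (simp add: sum.neutral)
    with ker[OF i(1)] nz show "x k = 0" by simp
  qed
qed

text \<open>The \<open>LEAST\<close> in \<open>min_skew_rank\<close> is meaningful once some
  admissible matrix exists.\<close>

lemma min_skew_rank_attained:
  assumes G: "pair_graph G"
  shows "\<exists>vs A. distinct vs \<and> set vs = pverts G \<and> A \<in> skew_mats vs G \<and>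
    min_skew_rank G = vec_space.rank (length vs) A"
proof -
  interpret pair_graph G by fact
  obtain vs where vs: "set vs = pverts G" "distinct vs"
    using finite_distinct_list[OF pair_finite_verts] by blast
  \<comment> \<open>Orienting every edge from the smaller to the larger index yields a
    skew-symmetric matrix with entries 0, 1 and -1.\<close>
  let ?A = "mat (length vs) (length vs) (\<lambda>(i, j). if (vs ! i, vs ! j) \<in> parcs G
     then if i < j then 1 else if j < i then - 1 else 0 else (0::real))"
  have "?A \<in> skew_mats vs G"
    unfolding skew_mats_def by (auto intro!: eq_matI dest: arcs_symmetric)
  then have "\<exists>r vs A. distinct vs \<and> set vs = pverts G \<and> A \<in> skew_mats vs G \<and>
      r = vec_space.rank (length vs) A"
    using vs by blast
  from LeastI_ex[OF this] show ?thesis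
    unfolding min_skew_rank_def .
qed

lemma card_le_min_skew_rank:
  assumes G: "pair_graph G" and forced: "pverts G \<subseteq> skew_forced (parcs G) B"
  shows "card (pverts G - B) \<le> min_skew_rank G"
proof -
  obtain vs A where vs: "distinct vs" "set vs = pverts G" and A: "A \<in> skew_mats vs G"
    and r: "min_skew_rank G = vec_space.rank (length vs) A"
    using min_skew_rank_attained[OF G] by blast
  let ?S = "{j. j < length vs \<and> vs ! j \<notin> B}"
  have "(!) vs ` ?S = pverts G - B"
    unfolding vs(2)[symmetric] by (auto simp: in_set_conv_nth)
  moreover have "inj_on ((!) vs) ?S"
    using vs(1) by (auto simp: inj_on_def nth_eq_iff_index_eq)
  ultimately have "card (pverts G - B) = card ?S"
    by (metis card_image)
  also have "\<dots> \<le> vec_space.rank (length vs) A"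
  proof (rule vec_space.card_le_rank[of _ _ "length vs"])
    show "A \<in> carrier_mat (length vs) (length vs)"
      using A by (simp add: skew_mats_def)
    fix x
    assume ker: "\<And>i. i < length vs \<Longrightarrow> (\<Sum>j\<in>?S. A $$ (i, j) * x j) = 0"
    show "\<forall>j\<in>?S. x j = 0"
    proof
      fix j
      assume j: "j \<in> ?S"
      then have "vs ! j \<in> skew_forced (parcs G) B"
        using forced vs(2) by auto
      from skew_forced_imp_kernel_zero[OF G vs A refl ker this] j show "x j = 0"
        by blast
    qed
  qed auto
  finally show ?thesis
    using r by simp
qed

text \<open>Vertices outside \<open>S\<close> lie in the closure by \<open>base\<close>, so only
  those of \<open>S\<close> remain to be forced. All lower bounds below are obtained in this
  form.\<close>

lemma card_forced_le_min_skew_rank: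
  assumes "pair_graph G" "S \<subseteq> pverts G" "S \<subseteq> skew_forced (parcs G) (pverts G - S)"
  shows "card S \<le> min_skew_rank G"
proof -
  have "pverts G \<subseteq> skew_forced (parcs G) (pverts G - S)"
    using assms(3) skew_forced.base[of _ "pverts G - S" "parcs G"] by blast
  moreover have "pverts G - (pverts G - S) = S"
    using assms(2) by blast
  ultimately show ?thesis
    using card_le_min_skew_rank[OF assms(1)] by metis
qed

text \<open>No edge joins two vertices outside \<open>C\<close> and the diagonal is zero, so the
  column of a vertex outside \<open>C\<close> is supported on the rows of \<open>C\<close>.\<close>

lemma min_skew_rank_le_vertex_cover:
  assumes G: "pair_graph G" and C: "finite C"
    and cover: "\<And>u w. (u, w) \<in> parcs G \<Longrightarrow> u \<in> C \<or> w \<in> C"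
  shows "min_skew_rank G \<le> 2 * card C"
proof -
  obtain vs A where vs: "distinct vs" "set vs = pverts G" and A: "A \<in> skew_mats vs G"
    and r: "min_skew_rank G = vec_space.rank (length vs) A"
    using min_skew_rank_attained[OF G] by blast
  define m where "m = length vs"
  interpret vec_space "TYPE(real)" m .
  have A': "A \<in> carrier_mat m m" "transpose_mat A = - A"
    and pat: "\<And>i j. \<lbrakk>i < m; j < m; i \<noteq> j\<rbrakk>
      \<Longrightarrow> A $$ (i, j) \<noteq> 0 \<longleftrightarrow> (vs ! i, vs ! j) \<in> parcs G"
    using A by (auto simp: skew_mats_def m_def)
  have diag: "A $$ (i, i) = 0" if "i < m" for i
    using arg_cong[OF A'(2), of "\<lambda>M. M $$ (i, i)"] A'(1) that by simp
  define I where "I = {i. i < m \<and> vs ! i \<in> C}"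
  have finI: "finite I" and Im: "\<And>k. k \<in> I \<Longrightarrow> k < m"
    unfolding I_def by simp_all
  have "card I \<le> card C"
  proof (rule card_inj_on_le[OF _ _ C])
    show "inj_on ((!) vs) I"
      using vs(1) by (auto simp: inj_on_def nth_eq_iff_index_eq I_def m_def)
  qed (auto simp: I_def)
  define X :: "real vec set" where "X = unit_vec m ` I"
  define Y where "Y = col A ` I \<union> X"
  have finY: "finite Y"
    unfolding Y_def X_def using finI by simp
  have cardY: "card Y \<le> 2 * card C"
  proof -
    have "card Y \<le> card (col A ` I) + card X"
      unfolding Y_def by (rule card_Un_le)
    also have "\<dots> \<le> card I + card I"
      unfolding X_def by (intro add_mono card_image_le finI)
    finally show ?thesis
      using \<open>card I \<le> card C\<close> by simp
  qed
  have X: "X \<subseteq> carrier_vec m"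
    unfolding X_def by auto
  then have Y: "Y \<subseteq> carrier_vec m"
    unfolding Y_def using A'(1) by auto
  have "col A j \<in> span Y" if j: "j < m" for j
  proof (cases "j \<in> I")
    case True
    then have "col A j \<in> Y"
      unfolding Y_def by blast
    then show ?thesis
      using in_own_span[of Y] Y by auto
  next
    case False
    have inj: "inj_on (unit_vec m :: nat \<Rightarrow> real vec) I"
      unfolding I_def by (auto simp: inj_on_def unit_vec_eq)
    \<comment> \<open>The unit vector at \<open>k\<close> is to receive entry \<open>k\<close> of
      the column. Since \<open>lincomb\<close> indexes coefficients by vectors, \<open>k\<close> is
      recovered by inverting \<open>unit_vec m\<close> on \<open>I\<close>.\<close>
    define a where "a = (\<lambda>v::real vec. col A j $ the_inv_into I (unit_vec m) v)"
    have "lincomb a X = col A j"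
    proof (rule eq_vecI)
      have carr: "dim_vec (lincomb a X) = m"
        by (rule lincomb_dim) (use X finI in \<open>auto simp: X_def\<close>)
      then show "dim_vec (lincomb a X) = dim_vec (col A j)"
        using A'(1) by simp
      fix i
      assume "i < dim_vec (col A j)"
      then have i: "i < m"
        using A'(1) by simp
      have "lincomb a X $ i = (\<Sum>k\<in>I. a (unit_vec m k) * unit_vec m k $ i)"
        unfolding lincomb_index[OF i X] unfolding X_def by (simp add: sum.reindex[OF inj])
      also have "\<dots> = (\<Sum>k\<in>I. if k = i then col A j $ i else 0)"
        by (rule sum.cong) (use i Im in \<open>auto simp: a_def the_inv_into_f_f[OF inj]\<close>)
      also have "\<dots> = (if i \<in> I then col A j $ i else 0)"
        using finI by simp
      also have "\<dots> = col A j $ i"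
      proof (cases "i \<in> I")
        case nI: False
        have "A $$ (i, j) = 0"
        proof (cases "i = j")
          case True
          then show ?thesis using diag j by simp
        next
          case ij: False
          have "(vs ! i, vs ! j) \<notin> parcs G"
            using cover nI False i j by (auto simp: I_def)
          then show ?thesis
            using pat[OF i j ij] by simp
        qed
        with nI i j A'(1) show ?thesis by simp
      qed simp
      finally show "lincomb a X $ i = col A j $ i" .
    qed
    then have "col A j \<in> span X"
      using finite_span[of X] X finI unfolding X_def by (simp, metis)
    moreover have "span X \<subseteq> span Y"
      by (rule span_is_monotone) (auto simp: Y_def)
    ultimately show ?thesis by blast
  qed
  then have "set (cols A) \<subseteq> span Y"
    using A'(1) by (auto simp: cols_def)
  from rank_le_card_spanning[OF A'(1) finY Y this] cardY r show ?thesis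
    by (simp add: m_def)
qed

section \<open>Paths in trees\<close>

lemma set_vwalk_arcs_conv_nth:
  "set (vwalk_arcs q) = {(q ! i, q ! Suc i) | i. Suc i < length q}"
proof (induction q rule: vwalk_arcs.induct)
  case (3 x y q)
  have "{((x # y # q) ! i, (x # y # q) ! Suc i) | i. Suc i < length (x # y # q)} =
      insert (x, y) {((y # q) ! i, (y # q) ! Suc i) | i. Suc i < length (y # q)}" (is "?L = ?R")
  proof
    show "?L \<subseteq> ?R"
    proof
      fix e assume "e \<in> ?L"
      then obtain i where "e = ((x # y # q) ! i, (x # y # q) ! Suc i)" "Suc i < length (x # y # q)"
        by blast
      then show "e \<in> ?R" by (cases i) auto
    qed
    show "?R \<subseteq> ?L"
      by (force intro: exI[of _ "0::nat"] exI[of _ "Suc _"])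
  qed
  with 3 show ?case by simp
qed auto

lemma set_vwalk_arcs_subset_iff_successively:
  "set (vwalk_arcs q) \<subseteq> E \<longleftrightarrow> successively (\<lambda>u w. (u, w) \<in> E) q"
  by (induction q rule: vwalk_arcs.induct) auto

lemma vwalk_iff_successively:
  "vwalk q (with_proj G) \<longleftrightarrow>
    q \<noteq> [] \<and> set q \<subseteq> pverts G \<and> successively (\<lambda>u w. (u, w) \<in> parcs G) q"
  by (auto simp: vwalk_def set_vwalk_arcs_subset_iff_successively)

lemma pawalk_verts_vwalk_arcs: "pawalk_verts u (vwalk_arcs (u # q)) = u # q"
  by (induction q arbitrary: u) auto

lemma pcas_vwalk_arcs: "pcas u (vwalk_arcs (u # q)) (last (u # q))"
  by (induction q arbitrary: u) auto

lemma undirected_treeD: "undirected_tree T \<Longrightarrow> pair_graph T"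
  by (simp add: undirected_tree_def)

text \<open>A list of at least four vertices has at least three arcs and would be a forbidden cycle.
  Lists of length 3 do occur: going along an edge and back.\<close>

lemma closed_vwalk_length_le:
  assumes T: "undirected_tree T" and q: "vwalk q (with_proj T)"
    and closed: "hd q = last q" and dist: "distinct (tl q)"
  shows "length q \<le> 3"
proof (rule ccontr)
  assume len: "\<not> length q \<le> 3"
  obtain u qs where qs: "q = u # qs"
    using len by (cases q) auto
  interpret pair_graph T
    using undirected_treeD[OF T] .
  have "awalk u (vwalk_arcs q) u"
    using q closed pcas_vwalk_arcs[of u qs] pawalk_verts_vwalk_arcs[of u qs]
    by (auto simp: awalk_def vwalk_def qs)
  then have "cycle (vwalk_arcs q)"
    using len dist pawalk_verts_vwalk_arcs[of u qs]
    by (auto simp: cycle_def qs)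
  moreover have "3 \<le> length (vwalk_arcs q)"
    using len vwalk_length_simp[of q] unfolding vwalk_length_def by linarith
  ultimately show False
    using T by (auto simp: undirected_tree_def)
qed

text \<open>Two paths that part after \<open>x\<close> and meet again form a closed walk. Its length
  bound makes both run directly from \<open>x\<close> to the same vertex, so they did not
  part.\<close>

lemma vpath_unique:
  assumes T: "undirected_tree T"
  shows "\<lbrakk>vpath q (with_proj T); vpath r (with_proj T); hd q = hd r; last q = last r\<rbrakk> \<Longrightarrow> q = r"
proof (induction q arbitrary: r)
  case Nil
  then show ?case by (simp add: vpath_def vwalk_def)
next
  case (Cons x q)
  interpret pair_graph T
    using undirected_treeD[OF T] .
  let ?adj = "\<lambda>u w. (u, w) \<in> parcs T"
  obtain r' where r: "r = x # r'"
    using Cons.prems by (cases r) (auto simp: vpath_def vwalk_def)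
  have Q: "set (x # q) \<subseteq> pverts T" "successively ?adj (x # q)" "distinct (x # q)"
    and R: "set (x # r') \<subseteq> pverts T" "successively ?adj (x # r')" "distinct (x # r')"
    using Cons.prems(1,2) by (auto simp: vpath_def vwalk_iff_successively r)
  show ?case
  proof (cases "q = [] \<or> r' = []")
    case True
    have "q = [] \<and> r' = []"
    proof (rule ccontr)
      assume "\<not> (q = [] \<and> r' = [])"
      with True Cons.prems(4) r have "x \<in> set q \<or> x \<in> set r'"
        by (metis last.simps last_in_set)
      with Q(3) R(3) show False by auto
    qed
    with r show ?thesis by simp
  next
    case False
    show ?thesis
    proof (cases "hd q = hd r'")
      case True
      have "vpath q (with_proj T)" "vpath r' (with_proj T)"
        using Q R False by (auto simp: vpath_def vwalk_iff_successively successively_Cons)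
      moreover have "last q = last r'"
        using Cons.prems(4) False r by simp
      ultimately show ?thesis
        using Cons.IH[of r'] True r by simp
    next
      case hd: False
      have "last q = last r'"
        using Cons.prems(4) False r by simp
      then have "last r' \<in> set q"
        using False last_in_set[of q] by simp
      then have "\<exists>z\<in>set r'. z \<in> set q"
        using False last_in_set by blast
      \<comment> \<open>Choosing the first vertex of \<open>r'\<close> that lies on \<open>q\<close>
        keeps the way back along \<open>r\<close> disjoint from the way out along
        \<open>q\<close>.\<close>
      then obtain rs z rs' where z: "r' = rs @ z # rs'" "z \<in> set q" "\<forall>y\<in>set rs. y \<notin> set q"
        using split_list_first_prop[of r' "\<lambda>y. y \<in> set q"] by blast
      obtain qs qs' where q: "q = qs @ z # qs'"
        using z(2) by (meson split_list)
      let ?c = "x # qs @ z # rev (x # rs)"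
      have sQ: "successively ?adj (x # qs @ [z])"
      proof -
        have "successively ?adj ((x # qs @ [z]) @ qs')"
          using Q(2) q by simp
        then show ?thesis
          unfolding successively_append_iff by blast
      qed
      have "successively ?adj ((x # rs @ [z]) @ rs')"
        using R(2) z(1) by simp
      then have "successively ?adj (x # rs @ [z])"
        unfolding successively_append_iff by blast
      then have "successively (\<lambda>u w. ?adj w u) (rev (x # rs @ [z]))"
        by (simp only: successively_rev)
      from successively_mono[OF this arcs_symmetric]
      have sR: "successively ?adj (z # rev (x # rs))"
        by simp
      have "successively ?adj ((x # qs) @ z # rev (x # rs))"
        using sQ sR by (subst (asm) append_Cons[symmetric])
          (auto simp: successively_append_iff simp del: append_Cons rev.simps)
      then have "vwalk ?c (with_proj T)"
        using Q(1) R(1) by (auto simp: vwalk_iff_successively q z(1))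
      moreover have "distinct (tl ?c)"
        using Q(3) R(3) z(3) by (auto simp: q z(1))
      ultimately have "length ?c \<le> 3"
        by (intro closed_vwalk_length_le[OF T]) auto
      then have "qs = []" "rs = []"
        by auto
      then show ?thesis
        using hd q z(1) by simp
    qed
  qed
qed

text \<open>Induction along a walk starting in \<open>S\<close>. It serves to show that the path and
  its leg ends exhaust a tree.\<close>

lemma connected_subset_closed:
  assumes G: "pair_graph G" and conn: "Digraph_Component.connected (with_proj G)"
    and S: "S \<inter> pverts G \<noteq> {}"
    and closed: "\<And>u w. \<lbrakk>u \<in> S; (u, w) \<in> parcs G\<rbrakk> \<Longrightarrow> w \<in> S"
  shows "pverts G \<subseteq> S"
proof
  interpret pair_graph G by fact
  fix w
  assume w: "w \<in> pverts G"
  obtain u where u: "u \<in> S" "u \<in> pverts G"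
    using S by blast
  have "strongly_connected (with_proj G)"
    using symmetric_connected_imp_strongly_connected[OF pair_sym_arcs conn] .
  then have "u \<rightarrow>\<^sup>*\<^bsub>with_proj G\<^esub> w"
    using u w by auto
  then obtain q where q: "vwalk q (with_proj G)" "hd q = u" "last q = w"
    unfolding reachable_vwalk_conv by blast
  have *: "successively (\<lambda>u w. (u, w) \<in> parcs G) q \<Longrightarrow> q \<noteq> [] \<Longrightarrow> hd q \<in> S \<Longrightarrow> last q \<in> S" for q
    using closed by (induction q rule: induct_list012) auto
  show "w \<in> S"
    using *[of q] q u by (simp add: vwalk_iff_successively)
qed

text \<open>By uniqueness, every path in a tree is a shortest one between its ends, so its length is
  a distance.\<close>

lemma vpath_length_le_diameter:
  assumes T: "undirected_tree T" and q: "vpath q (with_proj T)"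
  shows "vwalk_length q \<le> diameter T"
proof -
  interpret pair_graph T
    using undirected_treeD[OF T] .
  have "graph_dist T (hd q) (last q) = vwalk_length q"
    unfolding graph_dist_def
  proof (rule Least_equality)
    fix k
    assume "\<exists>r. vpath r (with_proj T) \<and> hd r = hd q \<and> last r = last q \<and> k = vwalk_length r"
    then show "vwalk_length q \<le> k"
      using vpath_unique[OF T q] by (metis order_refl)
  qed (use q in blast)
  moreover have "hd q \<in> pverts T" "last q \<in> pverts T"
    using q by (auto simp: vpath_def vwalk_def)
  ultimately have "vwalk_length q \<in> {graph_dist T u v | u v. u \<in> pverts T \<and> v \<in> pverts T}"
    by (metis (mono_tags, lifting) mem_Collect_eq)
  moreover have "{graph_dist T u v | u v. u \<in> pverts T \<and> v \<in> pverts T} =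
      (\<lambda>(u, v). graph_dist T u v) ` (pverts T \<times> pverts T)"
    by auto
  then have "finite {graph_dist T u v | u v. u \<in> pverts T \<and> v \<in> pverts T}"
    using pair_finite_verts by simp
  ultimately show ?thesis
    unfolding diameter_def by (simp add: Max_ge del: vwalk_length_simp)
qed

section \<open>Graphs with an induced path\<close>

text \<open>Acyclicity is not assumed, so that the bounds apply to \<open>path_graph p\<close> as
  well as to the tree. Inducedness is expressed through positions on \<open>p\<close>.\<close>

locale induced_path =
  fixes G :: "'a pair_pre_digraph" and p :: "'a list"
  assumes graph: "pair_graph G"
    and path_distinct: "distinct p"
    and path_verts: "set p \<subseteq> pverts G"
    and path_arcs: "\<lbrakk>i < length p; j < length p\<rbrakk>
      \<Longrightarrow> (p ! i, p ! j) \<in> parcs G \<longleftrightarrow> j = Suc i \<or> i = Suc j"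
begin

sublocale pair_graph G
  by (rule graph)

lemma path_nth_in: "i < length p \<Longrightarrow> p ! i \<in> pverts G"
  using path_verts nth_mem by blast

lemma path_neighbour_cases:
  assumes "(p ! i, w) \<in> parcs G" "i < length p"
  obtains (off) "w \<notin> set p" | (up) "Suc i < length p" "w = p ! Suc i"
    | (down) "0 < i" "w = p ! (i - 1)"
proof (cases "w \<in> set p")
  case True
  then obtain j where j: "j < length p" "w = p ! j"
    by (metis in_set_conv_nth)
  then have "j = Suc i \<or> i = Suc j"
    using assms path_arcs by blast
  then show ?thesis
    using j up down by auto
qed (use off in simp)

text \<open>A path with an even number of vertices is forced from both ends: every second vertex when
  moving away from the lower end, and the remaining ones when moving away from the upper end.\<close>

lemma segment_forced:
  assumes ab: "a \<le> b" "b \<le> length p" "even (b - a)"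
    and left: "a = 0 \<or> p ! (a - 1) \<in> skew_forced (parcs G) B"
    and right: "b = length p \<or> p ! b \<in> skew_forced (parcs G) B"
    and off: "\<And>i w. \<lbrakk>a \<le> i; i < b; (p ! i, w) \<in> parcs G; w \<notin> set p\<rbrakk>
      \<Longrightarrow> w \<in> skew_forced (parcs G) B"
    and i: "a \<le> i" "i < b"
  shows "p ! i \<in> skew_forced (parcs G) B"
proof -
  let ?F = "skew_forced (parcs G) B"
  \<comment> \<open>Row \<open>p ! (a + 2 * k)\<close> forces the vertex above it: the vertex below
    comes from the previous round or, for \<open>k = 0\<close>, from \<open>left\<close>.\<close>
  have fwd: "a + 2 * k + 1 < b \<longrightarrow> p ! (a + 2 * k + 1) \<in> ?F" for k
  proof (induction k)
    case 0
    show ?case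
    proof
      assume lt: "a + 2 * 0 + 1 < b"
      show "p ! (a + 2 * 0 + 1) \<in> ?F"
      proof (rule skew_forced.step[where u = "p ! a"])
        show "(p ! a, p ! (a + 2 * 0 + 1)) \<in> parcs G"
          using lt ab path_arcs by simp
        fix w assume w: "(p ! a, w) \<in> parcs G" "w \<noteq> p ! (a + 2 * 0 + 1)"
        have "a < length p" using lt ab by simp
        from w(1) this show "w \<in> ?F"
          by (cases rule: path_neighbour_cases) (use w lt left off[of a w] in auto)
      qed
    qed
  next
    case (Suc k)
    show ?case
    proof
      assume lt: "a + 2 * Suc k + 1 < b"
      have IH: "p ! (a + 2 * k + 1) \<in> ?F"
        using Suc lt by simp
      show "p ! (a + 2 * Suc k + 1) \<in> ?F"
      proof (rule skew_forced.step[where u = "p ! (a + 2 * Suc k)"])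
        show "(p ! (a + 2 * Suc k), p ! (a + 2 * Suc k + 1)) \<in> parcs G"
          using lt ab path_arcs by simp
        fix w assume w: "(p ! (a + 2 * Suc k), w) \<in> parcs G" "w \<noteq> p ! (a + 2 * Suc k + 1)"
        have "a + 2 * Suc k < length p" using lt ab by simp
        from w(1) this show "w \<in> ?F"
          by (cases rule: path_neighbour_cases)
            (use w lt IH off[of "a + 2 * Suc k" w] in auto)
      qed
    qed
  qed
  \<comment> \<open>The mirror image: row \<open>p ! (b - 1 - 2 * k)\<close> forces the vertex below
    it, starting from \<open>right\<close>.\<close>
  have bwd: "a + 2 * k + 2 \<le> b \<longrightarrow> p ! (b - 2 - 2 * k) \<in> ?F" for k
  proof (induction k)
    case 0
    show ?case
    proof
      assume le: "a + 2 * 0 + 2 \<le> b"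
      show "p ! (b - 2 - 2 * 0) \<in> ?F"
      proof (rule skew_forced.step[where u = "p ! (b - 1)"])
        have "b - 1 = Suc (b - 2)"
          using le by linarith
        then show "(p ! (b - 1), p ! (b - 2 - 2 * 0)) \<in> parcs G"
          using le ab path_arcs[of "b - 1" "b - 2"] by simp
        fix w assume w: "(p ! (b - 1), w) \<in> parcs G" "w \<noteq> p ! (b - 2 - 2 * 0)"
        have "b - 1 < length p" using le ab by simp
        from w(1) this show "w \<in> ?F"
        proof (cases rule: path_neighbour_cases)
          case up
          then show ?thesis using right le by auto
        next
          case down
          have "b - 1 - 1 = b - 2 - 2 * 0" by simp
          then show ?thesis using down w(2) by metis
        qed (use w le off[of "b - 1" w] in auto)
      qed
    qed
  next
    case (Suc k)
    show ?case
    proof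
      assume le: "a + 2 * Suc k + 2 \<le> b"
      define c where "c = b - 2 - 2 * Suc k"
      have c: "b - 2 - 2 * k = c + 2" "a \<le> c" "c + 2 < b"
        using le by (auto simp: c_def)
      have IH: "p ! (c + 2) \<in> ?F"
        using Suc le c(1) by simp
      show "p ! (b - 2 - 2 * Suc k) \<in> ?F"
        unfolding c_def[symmetric]
      proof (rule skew_forced.step[where u = "p ! (c + 1)"])
        show "(p ! (c + 1), p ! c) \<in> parcs G"
          using c ab path_arcs by simp
        fix w assume w: "(p ! (c + 1), w) \<in> parcs G" "w \<noteq> p ! c"
        have "c + 1 < length p" using c ab by simp
        from w(1) this show "w \<in> ?F"
          by (cases rule: path_neighbour_cases) (use w c IH off[of "c + 1" w] in auto)
      qed
    qed
  qed
  show ?thesis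
  \<comment> \<open>Positions at odd distance from \<open>a\<close> belong to the upward sweep. The
    others are at even distance from \<open>b\<close>, because \<open>b - a\<close> is even, and
    belong to the downward one.\<close>
  proof (cases "even (i - a)")
    case True
    then have "even (b - i)"
      using ab i by (metis dvd_diff_nat diff_diff_left le_add_diff_inverse)
    then obtain m where "b - i = 2 * m"
      by (elim evenE)
    then have m: "b = i + 2 * m"
      using i by simp
    then have "b - 2 - 2 * (m - 1) = i" "a + 2 * (m - 1) + 2 \<le> b"
      using i by simp_all
    with bwd[of "m - 1"] show ?thesis by simp
  next
    case False
    then obtain m where "i - a = 2 * m + 1"
      by (elim oddE)
    then have "i = a + 2 * m + 1"
      using i by simp
    with fwd[of m] i show ?thesis by simp
  qed
qed

section \<open>Lower bounds by forcing\<close>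

text \<open>For odd length the last vertex is left out of the forced set and acts as a known zero at
  the upper end.\<close>

lemma path_le_min_skew_rank: "2 * (length p div 2) \<le> min_skew_rank G"
proof -
  let ?b = "2 * (length p div 2)"
  let ?S = "set (take ?b p)"
  let ?F = "skew_forced (parcs G) (pverts G - ?S)"
  have "p ! i \<in> ?F" if "i < ?b" for i
  proof (rule segment_forced[of 0 ?b])
    have "p ! ?b \<notin> ?S" if "?b < length p"
      using that path_distinct by (auto simp: in_set_conv_nth nth_eq_iff_index_eq)
    then show "?b = length p \<or> p ! ?b \<in> ?F"
      using path_nth_in[of ?b] times_div_less_eq_dividend[of 2 "length p"]
      by (metis DiffI le_neq_implies_less skew_forced.base)
    fix i w
    assume "(p ! i, w) \<in> parcs G" "w \<notin> set p"
    then show "w \<in> ?F"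
      using in_arcsD2 by (auto intro!: skew_forced.base dest: in_set_takeD)
  qed (use that in auto)
  then have "?S \<subseteq> ?F"
    by (auto simp: in_set_conv_nth)
  moreover have "?S \<subseteq> pverts G"
    using path_verts set_take_subset by fastforce
  ultimately have "card ?S \<le> min_skew_rank G"
    using card_forced_le_min_skew_rank[OF graph] by blast
  then show ?thesis
    using path_distinct by (simp add: distinct_card)
qed

text \<open>The edge between \<open>a\<close> and \<open>c\<close> enlarges the matching on the
  path. As \<open>c\<close> has no neighbour on the path, its row forces \<open>a\<close>; then the
  path is forced, and finally row \<open>a\<close> forces \<open>c\<close>.\<close>

lemma far_vertex_le_min_skew_rank:
  assumes i: "u \<in> set p" "(u, a) \<in> parcs G" "(a, c) \<in> parcs G" "a \<notin> set p" "c \<notin> set p"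
    and c: "\<And>v. v \<in> set p \<Longrightarrow> (v, c) \<notin> parcs G"
  shows "2 * (length p div 2) + 2 \<le> min_skew_rank G"
proof -
  let ?b = "2 * (length p div 2)"
  let ?S = "insert a (insert c (set (take ?b p)))"
  let ?F = "skew_forced (parcs G) (pverts G - ?S)"
  have ac: "a \<noteq> c"
    using no_loops'[OF i(3)] .
  have base: "w \<in> ?F" if "(v, w) \<in> parcs G" "w \<noteq> a" "w \<noteq> c" "w \<notin> set p" for v w
    using that in_arcsD2[OF that(1)] by (auto intro!: skew_forced.base dest: in_set_takeD)
  have a: "a \<in> ?F"
  proof (rule skew_forced.step[where u = c])
    show "(c, a) \<in> parcs G"
      using arcs_symmetric i(3) .
    fix w assume w: "(c, w) \<in> parcs G" "w \<noteq> a"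
    then have "w \<notin> set p" "w \<noteq> c"
      using c arcs_symmetric no_loops' by blast+
    then show "w \<in> ?F"
      using base w by blast
  qed
  have p: "p ! j \<in> ?F" if "j < ?b" for j
  proof (rule segment_forced[of 0 ?b])
    have "p ! ?b \<notin> ?S" if "?b < length p"
      using that path_distinct i by (auto simp: in_set_conv_nth nth_eq_iff_index_eq)
    then show "?b = length p \<or> p ! ?b \<in> ?F"
      using path_nth_in[of ?b] times_div_less_eq_dividend[of 2 "length p"]
      by (metis DiffI le_neq_implies_less skew_forced.base)
    fix j w
    assume j: "j < ?b" and w: "(p ! j, w) \<in> parcs G" "w \<notin> set p"
    have "j < length p"
      using j by linarith
    then have "w \<noteq> c"
      using c w by auto
    then show "w \<in> ?F"
      using base[OF w(1)] w a by blast
  qed (use that in auto)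
  have path: "v \<in> ?F" if "v \<in> set p" for v
  proof (cases "v \<in> ?S")
    case True
    with that i have "v \<in> set (take ?b p)"
      by auto
    then obtain j where "j < ?b" "v = p ! j"
      by (auto simp: in_set_conv_nth)
    with p show ?thesis by simp
  next
    case False
    then show ?thesis
      using that path_verts by (auto intro: skew_forced.base)
  qed
  have "c \<in> ?F"
  proof (rule skew_forced.step[OF i(3)])
    fix w assume "(a, w) \<in> parcs G" "w \<noteq> c"
    moreover from this have "w \<noteq> a"
      using no_loops' by blast
    ultimately show "w \<in> ?F"
      using base path by blast
  qed
  with a path have "?S \<subseteq> ?F"
    by (auto dest: in_set_takeD)
  moreover have "?S \<subseteq> pverts G"
    using path_verts i in_arcsD2 by (auto dest: in_set_takeD)
  ultimately have "card ?S \<le> min_skew_rank G"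
    using card_forced_le_min_skew_rank[OF graph] by blast
  moreover have "card ?S = ?b + 2"
    using path_distinct i ac by (auto simp: distinct_card card_insert_if dest: in_set_takeD)
  ultimately show ?thesis by simp
qed

text \<open>Row \<open>w\<close> forces its only path neighbour \<open>p ! k\<close>. This cuts the
  path into segments of \<open>k\<close> and \<open>length p - 1 - k\<close> vertices, both even
  numbers, which are forced separately; then row \<open>p ! k\<close> forces
  \<open>w\<close>.\<close>

lemma even_position_leg_le_min_skew_rank:
  assumes n: "odd (length p)" and k: "k < length p" "even k"
    and w: "(p ! k, w) \<in> parcs G" "w \<notin> set p"
    and uniq: "\<And>j. \<lbrakk>j < length p; (p ! j, w) \<in> parcs G\<rbrakk> \<Longrightarrow> j = k"
  shows "length p + 1 \<le> min_skew_rank G"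
proof -
  let ?S = "insert w (set p)"
  let ?F = "skew_forced (parcs G) (pverts G - ?S)"
  have base: "x \<in> ?F" if "(v, x) \<in> parcs G" "x \<noteq> w" "x \<notin> set p" for v x
    using that in_arcsD2[OF that(1)] by (auto intro!: skew_forced.base)
  have pk: "p ! k \<in> ?F"
  proof (rule skew_forced.step[where u = w])
    show "(w, p ! k) \<in> parcs G"
      using arcs_symmetric w(1) .
    fix x assume x: "(w, x) \<in> parcs G" "x \<noteq> p ! k"
    have "x \<notin> set p"
    proof
      assume "x \<in> set p"
      then obtain j where "j < length p" "x = p ! j"
        by (metis in_set_conv_nth)
      then show False
        using uniq[of j] x arcs_symmetric by blast
    qed
    moreover have "x \<noteq> w"
      using no_loops' x(1) by blast
    ultimately show "x \<in> ?F"
      using base x by blast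
  qed
  have off: "x \<in> ?F" if "j < length p" "j \<noteq> k" "(p ! j, x) \<in> parcs G" "x \<notin> set p" for j x
    using that uniq base by blast
  have "p ! j \<in> ?F" if "j < k" for j
  proof (rule segment_forced[of 0 k])
    show "x \<in> ?F" if "i < k" "(p ! i, x) \<in> parcs G" "x \<notin> set p" for i x
      using that k off[of i x] by simp
  qed (use that k pk in auto)
  moreover have "p ! j \<in> ?F" if "k < j" "j < length p" for j
  proof (rule segment_forced[of "Suc k" "length p"])
    show "x \<in> ?F" if "Suc k \<le> i" "i < length p" "(p ! i, x) \<in> parcs G" "x \<notin> set p" for i x
      using that off[of i x] by simp
  qed (use that k n pk in auto)
  ultimately have path: "set p \<subseteq> ?F"
    using pk by (metis in_set_conv_nth linorder_neqE_nat subsetI)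
  moreover have "w \<in> ?F"
    by (rule skew_forced.step[OF w(1)]) (use path base in blast)
  ultimately have "?S \<subseteq> ?F"
    by blast
  moreover have "?S \<subseteq> pverts G"
    using path_verts w in_arcsD2 by blast
  ultimately have "card ?S \<le> min_skew_rank G"
    using card_forced_le_min_skew_rank[OF graph] by blast
  then show ?thesis
    using path_distinct w by (simp add: distinct_card)
qed

text \<open>The rows of the leg ends force both joints; \<open>nadj\<close> keeps the other leg end
  out of these rows. The joints cut the path into three segments, all of even size by the parities
  of \<open>k\<close>, \<open>l\<close> and \<open>length p\<close>. Finally the rows of the joints
  force the leg ends.\<close>

lemma even_odd_position_legs_le_min_skew_rank:
  assumes n: "even (length p)" and k: "k < l" "l < length p" "even k" "odd l"
    and w: "(p ! k, w) \<in> parcs G" "w \<notin> set p"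
    and z: "(p ! l, z) \<in> parcs G" "z \<notin> set p" and nadj: "(w, z) \<notin> parcs G"
    and uniq: "\<And>i j x. \<lbrakk>i < length p; j < length p; (p ! i, x) \<in> parcs G; (p ! j, x) \<in> parcs G;
      x \<notin> set p\<rbrakk> \<Longrightarrow> i = j"
  shows "length p + 2 \<le> min_skew_rank G"
proof -
  let ?S = "insert w (insert z (set p))"
  let ?F = "skew_forced (parcs G) (pverts G - ?S)"
  have wz: "w \<noteq> z"
    using uniq[of k l w] k w z by auto
  have base: "x \<in> ?F" if "(v, x) \<in> parcs G" "x \<noteq> w" "x \<noteq> z" "x \<notin> set p" for v x
    using that in_arcsD2[OF that(1)] by (auto intro!: skew_forced.base)
  have joint: "p ! i \<in> ?F"
    if y: "(p ! i, y) \<in> parcs G" "y \<in> {w, z}" "i < length p" for i y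
  proof (rule skew_forced.step[where u = y])
    show "(y, p ! i) \<in> parcs G"
      using arcs_symmetric y(1) .
    fix x assume x: "(y, x) \<in> parcs G" "x \<noteq> p ! i"
    have ynp: "y \<notin> set p"
      using y w z by auto
    have "x \<notin> set p"
    proof
      assume "x \<in> set p"
      then obtain j where "j < length p" "x = p ! j"
        by (metis in_set_conv_nth)
      then show False
        using uniq[of i j y] x y arcs_symmetric ynp by blast
    qed
    moreover have "x \<notin> {w, z}"
      using x(1) y(2) nadj arcs_symmetric no_loops' by blast
    ultimately show "x \<in> ?F"
      using base x by blast
  qed
  have pk: "p ! k \<in> ?F" and pl: "p ! l \<in> ?F"
    using joint[OF w(1)] joint[OF z(1)] k by auto
  have off: "x \<in> ?F"
    if "j < length p" "j \<noteq> k" "j \<noteq> l" "(p ! j, x) \<in> parcs G" "x \<notin> set p" for j x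
  proof -
    have "x \<noteq> w" "x \<noteq> z"
      using uniq[of j k x] uniq[of j l x] that w z k by auto
    then show ?thesis
      using base that by blast
  qed
  have "p ! j \<in> ?F" if "j < k" for j
  proof (rule segment_forced[of 0 k])
    show "x \<in> ?F" if "i < k" "(p ! i, x) \<in> parcs G" "x \<notin> set p" for i x
      using that k off[of i x] by simp
  qed (use that k pk in auto)
  moreover have "p ! j \<in> ?F" if "k < j" "j < l" for j
  proof (rule segment_forced[of "Suc k" l])
    show "x \<in> ?F" if "Suc k \<le> i" "i < l" "(p ! i, x) \<in> parcs G" "x \<notin> set p" for i x
      using that k off[of i x] by simp
  qed (use that k pk pl in auto)
  moreover have "p ! j \<in> ?F" if "l < j" "j < length p" for j
  proof (rule segment_forced[of "Suc l" "length p"])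
    show "x \<in> ?F" if "Suc l \<le> i" "i < length p" "(p ! i, x) \<in> parcs G" "x \<notin> set p" for i x
      using that k off[of i x] by simp
  qed (use that k n pl in auto)
  ultimately have "p ! j \<in> ?F" if "j < length p" for j
    using pk pl that by (metis linorder_neqE_nat)
  then have path: "set p \<subseteq> ?F"
    by (auto simp: in_set_conv_nth)
  have "w \<in> ?F"
  proof (rule skew_forced.step[OF w(1)])
    fix x assume x: "(p ! k, x) \<in> parcs G" "x \<noteq> w"
    have "x \<noteq> z"
      using uniq[of k l z] k x z by auto
    then show "x \<in> ?F"
      using base path x by blast
  qed
  moreover have "z \<in> ?F"
  proof (rule skew_forced.step[OF z(1)])
    fix x assume x: "(p ! l, x) \<in> parcs G" "x \<noteq> z"
    have "x \<noteq> w"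
      using uniq[of k l w] k x w by auto
    then show "x \<in> ?F"
      using base path x by blast
  qed
  ultimately have "?S \<subseteq> ?F"
    using path by blast
  moreover have "?S \<subseteq> pverts G"
    using path_verts w z in_arcsD2 by blast
  ultimately have "card ?S \<le> min_skew_rank G"
    using card_forced_le_min_skew_rank[OF graph] by blast
  then show ?thesis
    using path_distinct w z wz by (simp add: distinct_card)
qed

text \<open>In the 1-based indices of the theorem this cover takes the even vertices of the path up to
  index \<open>t\<close> and the odd ones after it.\<close>

definition switching_cover :: "nat \<Rightarrow> 'a set" where
  "switching_cover t =
    (\<lambda>k. p ! (if 2 * k < t then 2 * k + 1 else 2 * k)) ` {..<length p div 2}"

lemma odd_in_switching_cover: "\<lbrakk>i < length p; i < t; odd i\<rbrakk> \<Longrightarrow> p ! i \<in> switching_cover t"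
  unfolding switching_cover_def by (rule image_eqI[where x = "i div 2"]) (auto elim!: oddE)

text \<open>The cover picks one vertex from each pair of positions \<open>2 * k\<close>,
  \<open>2 * k + 1\<close>. With even length, the last even position also belongs to such a
  pair.\<close>

lemma even_in_switching_cover:
  "\<lbrakk>even (length p); i < length p; t \<le> i; even i\<rbrakk> \<Longrightarrow> p ! i \<in> switching_cover t"
  unfolding switching_cover_def by (rule image_eqI[where x = "i div 2"]) (auto elim!: evenE)

text \<open>Away from \<open>t\<close> the cover takes every second vertex. At an even
  \<open>t\<close> inside the path, the change of parity puts both \<open>t - 1\<close> and
  \<open>t\<close> into the cover, so no edge is missed; for \<open>t = length p\<close> the parity
  never changes.\<close>

lemma min_skew_rank_le_switching_cover:
  assumes t: "t = length p \<or> even (length p) \<and> even t"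
    and touch: "\<And>u w. (u, w) \<in> parcs G \<Longrightarrow> u \<in> set p \<or> w \<in> set p"
    and legs: "\<And>i w. \<lbrakk>i < length p; (p ! i, w) \<in> parcs G; w \<notin> set p\<rbrakk>
      \<Longrightarrow> p ! i \<in> switching_cover t"
  shows "min_skew_rank G \<le> 2 * (length p div 2)"
proof -
  have step: "p ! i \<in> switching_cover t \<or> p ! Suc i \<in> switching_cover t" if "Suc i < length p" for i
  proof (cases "odd i \<longleftrightarrow> i < t")
    case True
    with t that show ?thesis
      using odd_in_switching_cover[of i t] even_in_switching_cover[of i t] by auto
  next
    case False
    \<comment> \<open>Evenness of \<open>t\<close> matters here: an even \<open>i < t\<close>
      satisfies \<open>Suc i < t\<close>. For \<open>t = length p\<close> this is just
      \<open>Suc i < length p\<close>.\<close>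
    with t that have "if odd i then t \<le> Suc i \<and> even (length p) else Suc i < t"
      by (auto elim!: evenE oddE; presburger)
    with that show ?thesis
      using odd_in_switching_cover[of "Suc i" t] even_in_switching_cover[of "Suc i" t]
      by (auto split: if_splits)
  qed
  have cover: "u \<in> switching_cover t \<or> w \<in> switching_cover t"
    if uw: "(u, w) \<in> parcs G" and u: "u \<in> set p" for u w
  proof -
    obtain i where i: "i < length p" "u = p ! i"
      using u by (metis in_set_conv_nth)
    from uw[unfolded i(2)] i(1) show ?thesis
    proof (cases rule: path_neighbour_cases)
      case off
      then show ?thesis using legs uw i by blast
    next
      case up
      then show ?thesis using step i by blast
    next
      case down
      then show ?thesis using step[of "i - 1"] i by auto
    qed
  qed
  have "min_skew_rank G \<le> 2 * card (switching_cover t)"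
  proof (rule min_skew_rank_le_vertex_cover[OF graph])
    show "finite (switching_cover t)"
      by (simp add: switching_cover_def)
    show "u \<in> switching_cover t \<or> w \<in> switching_cover t" if "(u, w) \<in> parcs G" for u w
      using touch[OF that] cover that arcs_symmetric by blast
  qed
  also have "card (switching_cover t) \<le> length p div 2"
    unfolding switching_cover_def using card_image_le[of "{..<length p div 2}"] by fastforce
  finally show ?thesis by simp
qed

end

section \<open>The path as a graph of its own\<close>

lemma parcs_path_graph:
  "parcs (path_graph p) = {(p ! i, p ! j) | i j. i < length p \<and> j < length p \<and> (j = Suc i \<or> i = Suc j)}"
  unfolding path_graph_def by (auto simp: set_vwalk_arcs_conv_nth) (metis Suc_lessD)+

lemma induced_path_path_graph:
  assumes "distinct p"
  shows "induced_path (path_graph p) p"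
proof (rule induced_path.intro)
  show "pair_graph (path_graph p)"
  proof
    show "finite (parcs (path_graph p))"
      by (simp add: path_graph_def)
    show "symmetric (with_proj (path_graph p))"
      unfolding symmetric_def by (auto simp: parcs_path_graph intro!: symI)
  qed (use assms in \<open>auto simp: parcs_path_graph nth_eq_iff_index_eq, auto simp: path_graph_def\<close>)
  show "((p ! i, p ! j) \<in> parcs (path_graph p)) = (j = Suc i \<or> i = Suc j)"
    if "i < length p" "j < length p" for i j
    using that assms by (auto simp: parcs_path_graph nth_eq_iff_index_eq)
qed (use assms in \<open>auto simp: path_graph_def\<close>)

text \<open>Forcing and the cover by all odd positions give the same bound.\<close>

lemma min_skew_rank_path_graph:
  assumes "distinct p"
  shows "min_skew_rank (path_graph p) = 2 * (length p div 2)"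
proof (rule antisym)
  interpret induced_path "path_graph p" p
    using induced_path_path_graph[OF assms] .
  have ends: "u \<in> set p \<and> w \<in> set p" if "(u, w) \<in> parcs (path_graph p)" for u w
    using that by (auto simp: parcs_path_graph)
  show "min_skew_rank (path_graph p) \<le> 2 * (length p div 2)"
    by (rule min_skew_rank_le_switching_cover[of "length p"]) (use ends in blast)+
  show "2 * (length p div 2) \<le> min_skew_rank (path_graph p)"
    using path_le_min_skew_rank .
qed

section \<open>Trees with a diametrical path\<close>

locale tree_with_diametrical_path =
  fixes T :: "'a pair_pre_digraph" and p :: "'a list"
  assumes tree: "undirected_tree T" and diam: "diametrical_path T p"
begin

lemma path_T: "vpath p (with_proj T)" "vwalk_length p = diameter T" "distinct p" "set p \<subseteq> pverts T"
    "p \<noteq> []" "successively (\<lambda>u w. (u, w) \<in> parcs T) p"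
  using diam by (auto simp: diametrical_path_def vpath_def vwalk_iff_successively)

lemma path_graph_induced:
  "(u, w) \<in> parcs (path_graph p) \<longleftrightarrow> (u, w) \<in> parcs T \<and> u \<in> set p \<and> w \<in> set p"
proof -
  have "parcs (path_graph p) = {e \<in> parcs T. fst e \<in> set p \<and> snd e \<in> set p}"
    using diam by (auto simp: diametrical_path_def induced_subgraph_def path_graph_def)
  then show ?thesis by simp
qed

sublocale induced_path T p
proof (rule induced_path.intro)
  show "pair_graph T"
    using undirected_treeD[OF tree] .
  show "((p ! i, p ! j) \<in> parcs T) = (j = Suc i \<or> i = Suc j)"
    if "i < length p" "j < length p" for i j
    using that path_T path_graph_induced[of "p ! i" "p ! j"]
    by (auto simp: parcs_path_graph nth_eq_iff_index_eq)
qed (use path_T in auto)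

text \<open>The ear \<open>r\<close>, the segment of the path from \<open>p ! i\<close> to \<open>p ! j\<close> and the two connecting
  edges form a closed walk, which in a tree cannot have three distinct vertices.\<close>

lemma ear_length_le:
  assumes ij: "i \<le> j" "j < length p" and r: "r \<noteq> []" "distinct r" "set r \<inter> set p = {}"
      "set r \<subseteq> pverts T"
    and adj: "successively (\<lambda>u w. (u, w) \<in> parcs T) (p ! j # r @ [p ! i])"
  shows "j - i + length r \<le> 1"
proof -
  let ?adj = "\<lambda>u w. (u, w) \<in> parcs T"
  \<comment> \<open>The segment of the path from \<open>p ! i\<close> to \<open>p ! j\<close>; the
    ear then leads back from \<open>p ! j\<close> to \<open>p ! i\<close>.\<close>
  define q where "q = drop i (take (Suc j) p)"
  have len: "length q = Suc j - i"
    using ij by (simp add: q_def)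
  then have ne: "q \<noteq> []"
    using ij by auto
  have hd: "hd q = p ! i" and last: "last q = p ! j"
    using ij ne len by (auto simp: q_def hd_drop_conv_nth last_conv_nth)
  have q: "distinct q" "set q \<subseteq> set p"
    using path_distinct unfolding q_def by (auto dest!: in_set_dropD in_set_takeD)
  have "p = take i (take (Suc j) p) @ q @ drop (Suc j) p"
    unfolding q_def by (metis append.assoc append_take_drop_id)
  then have "successively ?adj q"
    using path_T(6) by (metis successively_append_iff)
  then have "successively ?adj (q @ r @ [p ! i])"
    using adj ne r(1) last by (auto simp: successively_append_iff successively_Cons)
  then have "vwalk (q @ r @ [p ! i]) (with_proj T)"
    using q r path_verts ij path_nth_in by (auto simp: vwalk_iff_successively)
  moreover have "distinct (tl (q @ r @ [p ! i]))"
  proof -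
    obtain q' where q': "q = p ! i # q'"
      using ne hd by (cases q) auto
    then show ?thesis
      using q r ij by auto
  qed
  ultimately have "length (q @ r @ [p ! i]) \<le> 3"
    using hd ne by (intro closed_vwalk_length_le[OF tree]) auto
  then show ?thesis
    using len ij by simp
qed

section \<open>Legs and joints of the tree\<close>

text \<open>A vertex attached to two path vertices is an ear of length 1, which leaves no room for
  \<open>i < j\<close>.\<close>

lemma leg_joint_unique:
  assumes "i < length p" "j < length p" "(p ! i, w) \<in> parcs T" "(p ! j, w) \<in> parcs T" "w \<notin> set p"
  shows "i = j"
proof -
  have *: "j - i + length [w] \<le> 1" if "i \<le> j" "j < length p" "(p ! i, w) \<in> parcs T" "(p ! j, w) \<in> parcs T" for i j
    by (rule ear_length_le) (use that assms(5) arcs_symmetric in_arcsD2 in auto)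
  show ?thesis
    using *[of i j] *[of j i] assms by (cases "i \<le> j") auto
qed

text \<open>Adjacent leg ends would form an ear of length 2, which is too long even if both legs
  share their joint.\<close>

lemma leg_ends_nonadjacent:
  assumes "u \<in> set p" "v \<in> set p" "(u, a) \<in> parcs T" "(v, c) \<in> parcs T" "a \<notin> set p" "c \<notin> set p"
  shows "(a, c) \<notin> parcs T"
proof
  assume ac: "(a, c) \<in> parcs T"
  obtain i j where ij: "i < length p" "u = p ! i" "j < length p" "v = p ! j"
    using assms(1,2) by (metis in_set_conv_nth)
  have *: False if "i \<le> j" "j < length p" "(p ! j, a) \<in> parcs T" "(p ! i, c) \<in> parcs T"
    "(a, c) \<in> parcs T" "a \<notin> set p" "c \<notin> set p" for i j a c
  proof -
    have "j - i + length [a, c] \<le> 1"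
      by (rule ear_length_le)
        (use that arcs_symmetric in_arcsD1 in_arcsD2 no_loops' in \<open>auto\<close>)
    then show False by simp
  qed
  show False
    \<comment> \<open>Exchanging the two legs covers the other order of the joints.\<close>
    using *[of i j c a] *[of j i a c] ij assms ac arcs_symmetric by (meson nle_le)
qed

text \<open>A leg at an end of \<open>p\<close> would extend it to a path longer than the
  diameter.\<close>

lemma joint_interior:
  assumes k: "k < length p" and w: "(p ! k, w) \<in> parcs T" "w \<notin> set p"
  shows "0 < k" "Suc k < length p"
proof -
  have no_longer: False if "vpath q (with_proj T)" "length q = Suc (length p)" for q
    using vpath_length_le_diameter[OF tree that(1)] path_T(2,5) that(2) by (cases p) auto
  have wT: "w \<in> pverts T"
    using in_arcsD2 w(1) .
  show "0 < k"
  proof (rule ccontr)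
    assume "\<not> 0 < k"
    then have "(w, hd p) \<in> parcs T"
      using w(1) path_T(5) arcs_symmetric by (simp add: hd_conv_nth)
    then have "vpath (w # p) (with_proj T)"
      using path_T wT w(2) by (auto simp: vpath_def vwalk_iff_successively successively_Cons)
    then show False
      by (rule no_longer) simp
  qed
  show "Suc k < length p"
  proof (rule ccontr)
    assume "\<not> Suc k < length p"
    then have "k = length p - 1"
      using k by simp
    then have "(last p, w) \<in> parcs T"
      using w(1) path_T(5) by (simp add: last_conv_nth)
    then have "vpath (p @ [w]) (with_proj T)"
      using path_T wT w(2) by (auto simp: vpath_def vwalk_iff_successively successively_append_iff)
    then show False
      by (rule no_longer) simp
  qed
qed

lemma interior_out_degree:
  assumes "0 < k" "Suc k < length p"
  shows "out_degree (with_proj (path_graph p)) (p ! k) \<noteq> 1"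
proof -
  interpret P: induced_path "path_graph p" p
    using induced_path_path_graph path_distinct .
  let ?O = "out_arcs (with_proj (path_graph p)) (p ! k)"
  have "(p ! k, p ! (k - 1)) \<in> ?O" "(p ! k, p ! Suc k) \<in> ?O"
    using assms P.path_arcs by (auto simp: out_arcs_def)
  moreover have "p ! (k - 1) \<noteq> p ! Suc k"
    using assms path_distinct by (simp add: nth_eq_iff_index_eq)
  ultimately have "card ?O \<noteq> 1"
    by (metis card_1_singletonE prod.inject singletonD)
  then show ?thesis
    by (simp add: out_degree_def)
qed

lemma mem_legs_iff: "(u, w) \<in> legs T p \<longleftrightarrow> (u, w) \<in> parcs T \<and> u \<in> set p \<and> w \<notin> set p"
  by (auto simp: legs_def)

text \<open>The passage between 1-based indices and list positions reverses parity: joints of even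
  index sit at odd positions.\<close>

lemma Suc_mem_joint_indices_iff:
  "Suc k \<in> joint_indices T p \<longleftrightarrow> k < length p \<and> (\<exists>w. (p ! k, w) \<in> parcs T \<and> w \<notin> set p)"
  by (auto simp: joint_indices_def legs_def image_def less_Suc_eq_le Suc_le_eq)

lemma centipede_arc_touches_path:
  assumes "centipede T p" "(u, w) \<in> parcs T"
  shows "u \<in> set p \<or> w \<in> set p"
proof -
  have "(u, w) \<in> parcs (path_graph p) \<union> legs T p \<union> (legs T p)\<inverse>"
    using assms unfolding centipede_def by metis
  then show ?thesis
    using path_graph_induced[of u w] mem_legs_iff by blast
qed

text \<open>By \<open>near\<close>, the path together with its leg ends is closed under adjacency,
  hence is everything by connectedness. The remaining conditions come from uniqueness and
  interiority of joints.\<close>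

lemma centipedeI:
  assumes near: "\<And>u a c. \<lbrakk>u \<in> set p; (u, a) \<in> parcs T; (a, c) \<in> parcs T\<rbrakk> \<Longrightarrow> a \<in> set p \<or> c \<in> set p"
  shows "centipede T p"
proof -
  let ?S = "set p \<union> snd ` legs T p"
  have conn: "Digraph_Component.connected (with_proj T)"
    using tree by (simp add: undirected_tree_def)
  have snd_legs: "w \<in> snd ` legs T p \<longleftrightarrow> (\<exists>u\<in>set p. (u, w) \<in> parcs T \<and> w \<notin> set p)" for w
  proof -
    have "w \<in> snd ` legs T p \<longleftrightarrow> (\<exists>u. (u, w) \<in> legs T p)"
      by force
    then show ?thesis
      by (auto simp: mem_legs_iff)
  qed
  have "pverts T \<subseteq> ?S"
  proof (rule connected_subset_closed[OF graph conn])
    show "?S \<inter> pverts T \<noteq> {}"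
      using path_verts path_T(5) by (cases p) auto
    show "w \<in> ?S" if "u \<in> ?S" "(u, w) \<in> parcs T" for u w
      using that near by (auto simp: snd_legs)
  qed
  moreover have "?S \<subseteq> pverts T"
    using path_verts in_arcsD2 by (auto simp: mem_legs_iff)
  ultimately have verts: "pverts T = ?S"
    by blast
  have touch: "u \<in> set p \<or> w \<in> set p" if uw: "(u, w) \<in> parcs T" for u w
    using in_arcsD1[OF uw] near uw by (auto simp: verts snd_legs)
  have arcs: "parcs T = parcs (path_graph p) \<union> legs T p \<union> (legs T p)\<inverse>"
  proof (rule Set.set_eqI)
    fix e
    show "e \<in> parcs T \<longleftrightarrow> e \<in> parcs (path_graph p) \<union> legs T p \<union> (legs T p)\<inverse>"
    proof (cases e)
      case (Pair u w)
      then show ?thesis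
        using touch[of u w] arcs_symmetric path_graph_induced[of u w]
        by (auto simp: mem_legs_iff)
    qed
  qed
  have "inj_on snd (legs T p)"
  proof (rule inj_onI)
    fix e f
    assume ef: "e \<in> legs T p" "f \<in> legs T p" "snd e = snd f"
    obtain u v w where uvw: "e = (u, w)" "f = (v, w)"
      using ef(3) by (cases e, cases f) auto
    then obtain i j where "i < length p" "u = p ! i" "j < length p" "v = p ! j"
      using ef by (auto simp: mem_legs_iff in_set_conv_nth)
    then show "e = f"
      using leg_joint_unique[of i j w] ef uvw by (auto simp: mem_legs_iff)
  qed
  moreover have "out_degree (with_proj (path_graph p)) u \<noteq> 1"
    if leg: "(u, w) \<in> legs T p" for u w
  proof -
    have "u \<in> set p"
      using leg by (simp add: mem_legs_iff)
    then obtain k where "k < length p" "u = p ! k"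
      by (metis in_set_conv_nth)
    then show ?thesis
      using leg joint_interior[of k w] interior_out_degree by (auto simp: mem_legs_iff)
  qed
  ultimately show ?thesis
    unfolding centipede_def using tree path_T(1) verts arcs by blast
qed

section \<open>Necessity of the conditions\<close>

text \<open>Otherwise some edge between \<open>a\<close> and \<open>c\<close> misses the path while
  \<open>a\<close> is a leg end. Then \<open>c\<close> has no path neighbour, since leg ends are
  nonadjacent, and the rank is too large.\<close>

lemma centipede_if_min_skew_rank_le:
  assumes "min_skew_rank T \<le> 2 * (length p div 2)"
  shows "centipede T p"
proof (rule centipedeI, rule ccontr)
  fix u a c
  assume u: "u \<in> set p" and ua: "(u, a) \<in> parcs T" and ac: "(a, c) \<in> parcs T"
    and "\<not> (a \<in> set p \<or> c \<in> set p)"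
  then have out: "a \<notin> set p" "c \<notin> set p"
    by auto
  have "(v, c) \<notin> parcs T" if "v \<in> set p" for v
    using leg_ends_nonadjacent[OF u that ua _ out] ac by blast
  from far_vertex_le_min_skew_rank[OF u ua ac out this] assms show False
    by simp
qed

text \<open>An odd index is an even position, where a leg raises the rank to at least
  \<open>length p + 1\<close>.\<close>

lemma even_joints_if_min_skew_rank_le:
  assumes n: "odd (length p)" and le: "min_skew_rank T \<le> 2 * (length p div 2)"
    and i: "i \<in> joint_indices T p"
  shows "even i"
proof (rule ccontr)
  assume odd: "odd i"
  then obtain k where k: "i = Suc k" "even k"
    by (cases i) auto
  then obtain w where w: "k < length p" "(p ! k, w) \<in> parcs T" "w \<notin> set p"
    using i Suc_mem_joint_indices_iff by blast
  have "length p + 1 \<le> min_skew_rank T"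
    using even_position_leg_le_min_skew_rank[OF n w(1) k(2) w(2,3)] leg_joint_unique w by blast
  then show False
    using le by simp
qed

lemma no_odd_even_joints_if_min_skew_rank_le:
  assumes n: "even (length p)" and le: "min_skew_rank T \<le> 2 * (length p div 2)"
    and r: "r \<in> joint_indices T p" "odd r" and s: "s \<in> joint_indices T p" "even s"
  shows "s < r"
proof (rule ccontr)
  assume "\<not> s < r"
  \<comment> \<open>The index 0 is even, so it must be excluded before \<open>s\<close> can be
    written as \<open>Suc l\<close>.\<close>
  have "s \<noteq> 0"
    using s by (auto simp: joint_indices_def)
  then obtain k l where kl: "r = Suc k" "s = Suc l" "even k" "odd l" "k < l"
    using r(2) s(2) \<open>\<not> s < r\<close> by (cases r; cases s; cases "r = s") auto
  obtain w where w: "(p ! k, w) \<in> parcs T" "w \<notin> set p" and k: "k < length p"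
    using r(1) kl(1) Suc_mem_joint_indices_iff by blast
  obtain z where z: "(p ! l, z) \<in> parcs T" "z \<notin> set p" and l: "l < length p"
    using s(1) kl(2) Suc_mem_joint_indices_iff by blast
  have "(w, z) \<notin> parcs T"
    using leg_ends_nonadjacent[OF _ _ w(1) z(1) w(2) z(2)] k l by simp
  then have "length p + 2 \<le> min_skew_rank T"
    using even_odd_position_legs_le_min_skew_rank[OF n kl(5) l kl(3,4) w z] leg_joint_unique by blast
  then show False
    using le by simp
qed

section \<open>Sufficiency of the conditions\<close>

lemma min_skew_rank_le_if_even_joints:
  assumes "centipede T p" and joints: "\<forall>i\<in>joint_indices T p. even i"
  shows "min_skew_rank T \<le> 2 * (length p div 2)"
proof (rule min_skew_rank_le_switching_cover[of "length p"])
  fix i w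
  assume "i < length p" "(p ! i, w) \<in> parcs T" "w \<notin> set p"
  moreover from this have "even (Suc i)"
    using joints Suc_mem_joint_indices_iff by blast
  ultimately show "p ! i \<in> switching_cover (length p)"
    by (intro odd_in_switching_cover) auto
qed (use centipede_arc_touches_path[OF assms(1)] in auto)

text \<open>The cover switches at the largest even joint index \<open>t\<close>. Even joints
  \<open>s \<le> t\<close> sit at odd positions below \<open>t\<close>, odd joints
  \<open>r > t\<close> at even positions from \<open>t\<close> on, so all joints are
  covered.\<close>

lemma min_skew_rank_le_if_separated_joints:
  assumes n: "even (length p)" and cp: "centipede T p"
    and sep: "\<And>r s. \<lbrakk>r \<in> joint_indices T p; s \<in> joint_indices T p; odd r; even s\<rbrakk> \<Longrightarrow> s < r"
  shows "min_skew_rank T \<le> 2 * (length p div 2)"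
proof -
  \<comment> \<open>The default 0 makes \<open>Max\<close> defined when there is no even joint; it
    is even, and the cover then consists of all even positions.\<close>
  let ?J = "insert 0 {s \<in> joint_indices T p. even s}"
  have "finite ?J"
    by (simp add: joint_indices_def)
  define t where "t = Max ?J"
  have "t \<in> ?J"
    unfolding t_def using \<open>finite ?J\<close> by (intro Max_in) auto
  have max: "s \<le> t" if "s \<in> joint_indices T p" "even s" for s
    unfolding t_def using \<open>finite ?J\<close> that by (intro Max_ge) auto
  show ?thesis
  proof (rule min_skew_rank_le_switching_cover[of t])
    show "t = length p \<or> even (length p) \<and> even t"
      using \<open>t \<in> ?J\<close> n by auto
    fix i w
    assume i: "i < length p" "(p ! i, w) \<in> parcs T" "w \<notin> set p"
    then have J: "Suc i \<in> joint_indices T p"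
      using Suc_mem_joint_indices_iff by blast
    show "p ! i \<in> switching_cover t"
    proof (cases "odd i")
      case True
      then show ?thesis
        using max[OF J] i by (intro odd_in_switching_cover) auto
    next
      case False
      then have "t < Suc i"
        using \<open>t \<in> ?J\<close> sep[OF J] by auto
      then show ?thesis
        using False i n by (intro even_in_switching_cover) auto
    qed
  qed (use centipede_arc_touches_path[OF cp] in auto)
qed

end

theorem theorem4p2:
  fixes T :: "'a pair_pre_digraph" and p :: "'a list" and n :: nat
  assumes "undirected_tree T"
    and "diametrical_path T p"
    and "length p = n"
  shows "(odd n \<longrightarrow>
            (min_skew_rank T = min_skew_rank (path_graph p) \<longleftrightarrow>
              regular_centipede T p \<and> (\<forall>i \<in> joint_indices T p. even i))) \<and>
         (even n \<longrightarrow>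
            (min_skew_rank T = min_skew_rank (path_graph p) \<longleftrightarrow>
              centipede T p \<and>
              \<not> (\<exists>r \<in> joint_indices T p. \<exists>s \<in> joint_indices T p.
                    odd r \<and> even s \<and> 3 \<le> r \<and> r < s \<and> s \<le> n - 2)))"
proof -
  interpret tree_with_diametrical_path T p
    using assms(1,2) by unfold_locales
  \<comment> \<open>The value for the path is a lower bound for \<open>T\<close> in any case, so
    equality reduces to the upper bound.\<close>
  have eq: "min_skew_rank T = min_skew_rank (path_graph p) \<longleftrightarrow>
      min_skew_rank T \<le> 2 * (length p div 2)"
    using min_skew_rank_path_graph[OF path_distinct] path_le_min_skew_rank by auto
  show ?thesis
  proof (intro conjI impI)
    assume n: "odd n"
    show "min_skew_rank T = min_skew_rank (path_graph p) \<longleftrightarrow>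
        regular_centipede T p \<and> (\<forall>i \<in> joint_indices T p. even i)"
      unfolding eq
    proof
      assume le: "min_skew_rank T \<le> 2 * (length p div 2)"
      have ev: "\<forall>i \<in> joint_indices T p. even i"
        using even_joints_if_min_skew_rank_le[OF _ le] n assms(3) by blast
      \<comment> \<open>Regularity follows from parity: consecutive indices cannot both be
        even.\<close>
      have "\<not> (\<exists>i. i \<in> joint_indices T p \<and> i + 1 \<in> joint_indices T p)"
      proof
        assume "\<exists>i. i \<in> joint_indices T p \<and> i + 1 \<in> joint_indices T p"
        then obtain i :: nat where "even i" "even (i + 1)"
          using ev by blast
        then show False by simp
      qed
      with ev centipede_if_min_skew_rank_le[OF le]
      show "regular_centipede T p \<and> (\<forall>i \<in> joint_indices T p. even i)"
        by (simp add: regular_centipede_def)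
    qed (use min_skew_rank_le_if_even_joints in \<open>auto simp: regular_centipede_def\<close>)
  next
    assume n: "even n"
    show "min_skew_rank T = min_skew_rank (path_graph p) \<longleftrightarrow>
        centipede T p \<and> \<not> (\<exists>r \<in> joint_indices T p. \<exists>s \<in> joint_indices T p.
          odd r \<and> even s \<and> 3 \<le> r \<and> r < s \<and> s \<le> n - 2)"
      unfolding eq
    proof
      assume le: "min_skew_rank T \<le> 2 * (length p div 2)"
      show "centipede T p \<and> \<not> (\<exists>r \<in> joint_indices T p. \<exists>s \<in> joint_indices T p.
          odd r \<and> even s \<and> 3 \<le> r \<and> r < s \<and> s \<le> n - 2)"
        using centipede_if_min_skew_rank_le[OF le]
          no_odd_even_joints_if_min_skew_rank_le[OF _ le] n assms(3) less_asym by blast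
    next
      assume cp: "centipede T p \<and> \<not> (\<exists>r \<in> joint_indices T p. \<exists>s \<in> joint_indices T p.
          odd r \<and> even s \<and> 3 \<le> r \<and> r < s \<and> s \<le> n - 2)"
      \<comment> \<open>With parity, interiority supplies the range conditions: an odd joint has
        index at least 3 and, \<open>n\<close> being even, an even joint has index at most
        \<open>n - 2\<close>.\<close>
      have interior: "1 < i \<and> i < n" if J: "i \<in> joint_indices T p" for i
      proof -
        obtain k where k: "i = Suc k"
          using J by (cases i) (auto simp: joint_indices_def)
        then obtain w where "k < length p" "(p ! k, w) \<in> parcs T" "w \<notin> set p"
          using J Suc_mem_joint_indices_iff by blast
        from joint_interior[OF this] k assms(3) show ?thesis by simp
      qed
      have "s < r" if J: "r \<in> joint_indices T p" "s \<in> joint_indices T p" and par: "odd r" "even s"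
        for r s
      proof (rule ccontr)
        assume "\<not> s < r"
        then have "r < s"
          using par by (cases "r = s") auto
        moreover have "3 \<le> r"
          using interior[OF J(1)] par(1) by (cases "r = 2") auto
        moreover have "s \<le> n - 2"
          using interior[OF J(2)] par(2) n by presburger
        ultimately show False
          using cp J par by blast
      qed
      then show "min_skew_rank T \<le> 2 * (length p div 2)"
        using min_skew_rank_le_if_separated_joints n assms(3) cp by simp
    qed
  qed
qed

end
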